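(* Let $\alpha\in\mathbb N^n$ and let $\mathcal A=\{u_1,\ldots,u_m\}$ be a set of monomials of $S=K[x_1,\ldots,x_n]$, minimal with respect to divisibility. Then $K[\mathcal A]$ is a normal ring if and only if $K[\mathcal A^\alpha]$ is a normal ring.
   Context: $\mathbb N$ denotes the positive integers. For $\alpha=(k_1,\ldots,k_n)$, $S^\alpha=K[x_{ij}:1\le i\le n,1\le j\le k_i]$, $\pi:S^\alpha\to S$, $x_{ij}\mapsto x_i$, and $\mathcal A^\alpha$ is the set of monomials $w\in S^\alpha$ with $\pi(w)\in\mathcal A$. $K[\mathcal B]$ is the $K$-subalgebra generated by a set $\mathcal B$ of monomials. *)

theory Defs
  imports "HOL-Library.Poly_Mapping" "HOL-Library.Product_Lexorder"
begin

text \<open>Polynomials over K in variables indexed by type 'v: finitely supported maps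
  from exponent vectors to coefficients. Monomials are identified with
  their exponent vectors.\<close>

type_synonym ('v, 'k) mpoly = "('v \<Rightarrow>\<^sub>0 nat) \<Rightarrow>\<^sub>0 'k"

definition monom :: "('v \<Rightarrow>\<^sub>0 nat) \<Rightarrow> ('v, 'k::field) mpoly" where
  "monom e = Poly_Mapping.single e 1"

definition const :: "'k \<Rightarrow> ('v, 'k::field) mpoly" where
  "const c = Poly_Mapping.single 0 c"

inductive_set kalg :: "('v \<Rightarrow>\<^sub>0 nat) set \<Rightarrow> ('v, 'k::field) mpoly set" for B where
  kalg_const: "const c \<in> kalg B"
| kalg_gen: "u \<in> B \<Longrightarrow> monom u \<in> kalg B"
| kalg_add: "p \<in> kalg B \<Longrightarrow> q \<in> kalg B \<Longrightarrow> p + q \<in> kalg B"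
| kalg_mult: "p \<in> kalg B \<Longrightarrow> q \<in> kalg B \<Longrightarrow> p * q \<in> kalg B"

text \<open>A subring R of a domain is normal if it is integrally closed in its field of
  fractions: every fraction a/b (a, b in R, b nonzero) that is integral over R lies in R.
  Integrality of a/b is written with denominators cleared.\<close>
definition normal_subring :: "'a::idom set \<Rightarrow> bool" where
  "normal_subring R \<longleftrightarrow>
     (\<forall>a\<in>R. \<forall>b\<in>R. b \<noteq> 0 \<longrightarrow>
        (\<exists>n>0. \<exists>c::nat \<Rightarrow> 'a. (\<forall>i<n. c i \<in> R) \<and>
            a ^ n + (\<Sum>i<n. c i * a ^ i * b ^ (n - i)) = 0)
        \<longrightarrow> (\<exists>r\<in>R. a = r * b))"

definition mdvd :: "('v \<Rightarrow>\<^sub>0 nat) \<Rightarrow> ('v \<Rightarrow>\<^sub>0 nat) \<Rightarrow> bool" where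
  "mdvd u v \<longleftrightarrow> (\<forall>i. Poly_Mapping.lookup u i \<le> Poly_Mapping.lookup v i)"

definition monomials_S :: "nat \<Rightarrow> (nat \<Rightarrow>\<^sub>0 nat) set" where
  "monomials_S n = {e. Poly_Mapping.keys e \<subseteq> {1..n}}"

text \<open>The map pi : x_ij \<mapsto> x_i on exponent vectors.\<close>
definition pi_map :: "((nat \<times> nat) \<Rightarrow>\<^sub>0 nat) \<Rightarrow> (nat \<Rightarrow>\<^sub>0 nat)" where
  "pi_map w = (\<Sum>p\<in>Poly_Mapping.keys w. Poly_Mapping.single (fst p) (Poly_Mapping.lookup w p))"

definition polarize :: "nat \<Rightarrow> (nat \<Rightarrow> nat) \<Rightarrow> (nat \<Rightarrow>\<^sub>0 nat) set \<Rightarrow> ((nat \<times> nat) \<Rightarrow>\<^sub>0 nat) set" where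
  "polarize n k A = {w. Poly_Mapping.keys w \<subseteq> {(i, j). 1 \<le> i \<and> i \<le> n \<and> 1 \<le> j \<and> j \<le> k i} \<and> pi_map w \<in> A}"

end

(* Comparing leading monomials reduces normality of K[B], for finite B, to normality of the
   monoid M generated by B. If f/g is integral over K[M], then d f^k / g^k lies in K[M] for all k and
   a fixed nonzero d. Passing to leading exponents, lead d + k (lead f - lead g) lies in M for all k.
   By Dickson's lemma two of these elements differ by an element of M, so a positive multiple of lead f - lead g
   lies in M, hence so does lead f - lead g by normality. One step of the division of f by g thus
   stays inside K[M], and well-foundedness of the monomial order finishes the division.

   On the monoid side, the monoid generated by the polarized monomials is the full preimage under
   pi of the monoid generated by A (a Riesz decomposition argument), and pi has an additive section,
   so normality transfers in both directions. *)
theory Submission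
  imports Complex_Main Defs
begin

section \<open>Exponent vectors\<close>

text \<open>Exponents of powers: \<open>monom a ^ c\<close> is \<open>monom (multiple c a)\<close>.
  As a repeated sum it commutes with additive maps by induction on \<open>c\<close>.\<close>

definition multiple :: "nat \<Rightarrow> ('v \<Rightarrow>\<^sub>0 nat) \<Rightarrow> ('v \<Rightarrow>\<^sub>0 nat)" where
  "multiple c e = (\<Sum>_<c. e)"

lemma lookup_multiple [simp]:
  "Poly_Mapping.lookup (multiple c e) x = c * Poly_Mapping.lookup e x"
  by (simp add: multiple_def lookup_sum)

lemma multiple_0 [simp]: "multiple 0 e = 0"
  by (simp add: multiple_def)

lemma multiple_Suc: "multiple (Suc c) e = e + multiple c e"
  by (simp add: multiple_def add.commute)

lemma keys_add_nat:
  fixes a b :: "'v \<Rightarrow>\<^sub>0 nat"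
  shows "Poly_Mapping.keys (a + b) = Poly_Mapping.keys a \<union> Poly_Mapping.keys b"
  by (auto simp: in_keys_iff lookup_add)

text \<open>\<open>update_induct\<close> adds a whole coordinate at once; the inner induction breaks
  it into units. This serves arguments that treat one variable at a time, such as
  \<open>pi_map_split\<close>.\<close>

lemma exponent_induct [case_names zero add_single]:
  fixes P :: "('v \<Rightarrow>\<^sub>0 nat) \<Rightarrow> bool"
  assumes "P 0" and step: "\<And>s x. P s \<Longrightarrow> P (s + Poly_Mapping.single x 1)"
  shows "P s"
proof (induction s rule: update_induct)
  case const
  show ?case by fact
next
  case (update f a b)
  have "P (f + Poly_Mapping.single a c)" for c
  proof (induction c)
    case 0
    show ?case using update by simp
  next
    case (Suc c)
    have "f + Poly_Mapping.single a (Suc c)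
        = (f + Poly_Mapping.single a c) + Poly_Mapping.single a 1"
      by (simp add: add.assoc single_add [symmetric])
    then show ?case using step [OF Suc] by simp
  qed
  moreover have "Poly_Mapping.update a b f = f + Poly_Mapping.single a b"
    using update.hyps(1)
    by (intro poly_mapping_eqI)
       (auto simp: lookup_update lookup_add lookup_single in_keys_iff when_def)
  ultimately show ?case by simp
qed

section \<open>Dickson's lemma\<close>

text \<open>Every real sequence, hence every sequence of naturals, has a monotone subsequence; if it
  decreases, it is constant from the index \<open>N\<close> of its least value on.\<close>

lemma nat_seq_mono_subseq:
  fixes s :: "nat \<Rightarrow> nat"
  shows "\<exists>\<phi>::nat \<Rightarrow> nat. strict_mono \<phi> \<and> mono (\<lambda>i. s (\<phi> i))"
proof -
  obtain \<phi> :: "nat \<Rightarrow> nat" where \<phi>: "strict_mono \<phi>" "monoseq (\<lambda>i. s (\<phi> i))"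
    using seq_monosub by blast
  show ?thesis
  proof (cases "incseq (\<lambda>i. s (\<phi> i))")
    case True
    then show ?thesis using \<phi> by blast
  next
    case False
    then have dec: "decseq (\<lambda>i. s (\<phi> i))"
      using \<phi>(2) by (simp add: monoseq_iff)
    obtain N where N: "\<And>i. s (\<phi> N) \<le> s (\<phi> i)"
      using ex_has_least_nat [of "\<lambda>_. True" 0 "\<lambda>i. s (\<phi> i)"] by blast
    have "s (\<phi> (N + i)) = s (\<phi> N)" for i
      using N [of "N + i"] dec by (intro antisym) (auto simp: decseq_def)
    then have "mono (\<lambda>i. s (\<phi> (N + i)))"
      by (simp add: mono_def)
    moreover have "strict_mono (\<lambda>i. \<phi> (N + i))"
      using \<phi>(1) by (simp add: strict_mono_def)
    ultimately show ?thesis by blast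
  qed
qed

text \<open>Coordinates are treated one after another: thinning out for a new coordinate preserves
  monotonicity in the old ones.\<close>

lemma dickson_subseq:
  fixes s :: "nat \<Rightarrow> 'a \<Rightarrow> nat"
  assumes "finite V"
  shows "\<exists>\<phi>::nat \<Rightarrow> nat. strict_mono \<phi> \<and> (\<forall>x\<in>V. mono (\<lambda>i. s (\<phi> i) x))"
  using assms
proof induction
  case empty
  show ?case using strict_mono_id by blast
next
  case (insert x V)
  then obtain \<phi> :: "nat \<Rightarrow> nat" where \<phi>: "strict_mono \<phi>" "\<forall>x\<in>V. mono (\<lambda>i. s (\<phi> i) x)"
    by blast
  obtain \<psi> :: "nat \<Rightarrow> nat" where \<psi>: "strict_mono \<psi>" "mono (\<lambda>i. s (\<phi> (\<psi> i)) x)"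
    using nat_seq_mono_subseq [of "\<lambda>i. s (\<phi> i) x"] by blast
  have "strict_mono (\<lambda>i. \<phi> (\<psi> i))"
    using \<phi>(1) \<psi>(1) by (simp add: strict_mono_def)
  moreover have "mono (\<lambda>i. s (\<phi> (\<psi> i)) y)" if "y \<in> V" for y
    using \<phi>(2) that strict_mono_mono [OF \<psi>(1)] by (simp add: mono_def)
  ultimately show ?case using \<psi>(2) by blast
qed

text \<open>Applied twice: to exponents, for termination of division, and to coefficient vectors
  over the generators, for almost integral elements.\<close>

lemma dickson:
  fixes s :: "nat \<Rightarrow> 'a \<Rightarrow> nat"
  assumes "finite V"
  obtains i j where "i < j" "\<forall>x\<in>V. s i x \<le> s j x"
proof -
  obtain \<phi> :: "nat \<Rightarrow> nat" where "strict_mono \<phi>" "\<forall>x\<in>V. mono (\<lambda>i. s (\<phi> i) x)"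
    using dickson_subseq [OF assms] by blast
  then have "\<phi> 0 < \<phi> 1" "\<forall>x\<in>V. s (\<phi> 0) x \<le> s (\<phi> 1) x"
    by (auto simp: strict_mono_def mono_def)
  then show thesis by (rule that)
qed

section \<open>Well-foundedness of the monomial order\<close>

lemma le_poly_mapping_add:
  fixes a b :: "'v::linorder \<Rightarrow>\<^sub>0 nat"
  shows "a \<le> a + b"
proof (induction b rule: exponent_induct)
  case zero
  show ?case by simp
next
  case (add_single b x)
  have "0 < Poly_Mapping.single x (1::nat)"
    by (auto simp: less_poly_mapping.rep_eq less_fun_def lookup_single when_def intro!: exI [of _ x])
  then have "0 \<le> Poly_Mapping.single x (1::nat)"
    by (rule less_imp_le)
  from add_mono [OF add_single this] show ?case
    by (simp add: add.assoc)
qed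

text \<open>The order is lexicographic with the smallest index decisive, so over infinitely many
  variables \<open>single 0 1 > single 1 1 > ...\<close> can descend forever. Over finite
  \<open>V\<close>, Dickson's lemma finds in any infinite chain an earlier monomial dividing a later
  one, and divisibility implies \<open>\<le>\<close>.\<close>

lemma wf_exponents:
  fixes V :: "'v::linorder set"
  assumes "finite V"
  shows "wf {(a, b :: 'v \<Rightarrow>\<^sub>0 nat). a < b \<and>
    Poly_Mapping.keys a \<subseteq> V \<and> Poly_Mapping.keys b \<subseteq> V}"
  unfolding wf_iff_no_infinite_down_chain
proof
  assume "\<exists>f. \<forall>i. (f (Suc i), f i) \<in> {(a, b :: 'v \<Rightarrow>\<^sub>0 nat). a < b \<and>
    Poly_Mapping.keys a \<subseteq> V \<and> Poly_Mapping.keys b \<subseteq> V}"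
  then obtain f :: "nat \<Rightarrow> 'v \<Rightarrow>\<^sub>0 nat"
    where dec: "\<And>i. f (Suc i) < f i" and keys: "\<And>i. Poly_Mapping.keys (f i) \<subseteq> V"
    by blast
  obtain i j where ij: "i < j" "\<forall>x\<in>V. Poly_Mapping.lookup (f i) x \<le> Poly_Mapping.lookup (f j) x"
    using dickson [OF assms, of "\<lambda>i. Poly_Mapping.lookup (f i)"] .
  have "Poly_Mapping.lookup (f i) x \<le> Poly_Mapping.lookup (f j) x" for x
    using ij(2) keys [of i] by (metis le0 not_in_keys_iff_lookup_eq_zero subsetD)
  then have "f j = f i + (f j - f i)"
    by (intro poly_mapping_eqI) (simp add: lookup_add lookup_minus)
  then have "f i \<le> f j"
    by (metis le_poly_mapping_add)
  moreover have "f j < f i"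
    using ij(1) by (induction rule: less_Suc_induct) (auto intro: dec less_trans)
  ultimately show False by simp
qed

section \<open>Normal monoids of exponents\<close>

text \<open>Generators enter one at a time, so that rule induction peels off a single generator, as
  \<open>monoid_span_polarize\<close> requires.\<close>

inductive_set monoid_span :: "'a::comm_monoid_add set \<Rightarrow> 'a set" for B where
  monoid_span_zero: "0 \<in> monoid_span B"
| monoid_span_gen_add: "u \<in> B \<Longrightarrow> e \<in> monoid_span B \<Longrightarrow> u + e \<in> monoid_span B"

lemma monoid_span_gen: "u \<in> B \<Longrightarrow> u \<in> monoid_span B"
  using monoid_span_gen_add [OF _ monoid_span_zero] by simp

lemma monoid_span_add:
  "a \<in> monoid_span B \<Longrightarrow> b \<in> monoid_span B \<Longrightarrow> a + b \<in> monoid_span B"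
  by (induction rule: monoid_span.induct) (auto simp: add.assoc intro: monoid_span.intros)

lemma monoid_span_multiple: "a \<in> monoid_span B \<Longrightarrow> multiple c a \<in> monoid_span B"
  by (induction c) (auto simp: multiple_Suc intro: monoid_span_zero monoid_span_add)

lemma monoid_span_sum:
  "(\<And>i. i \<in> I \<Longrightarrow> f i \<in> monoid_span B) \<Longrightarrow> sum f I \<in> monoid_span B"
  by (induction I rule: infinite_finite_induct) (auto intro: monoid_span_zero monoid_span_add)

text \<open>Supplies coefficient vectors over the finite set \<open>B\<close>, to which Dickson's
  lemma can be applied.\<close>

lemma monoid_span_imp_combination:
  assumes "finite B" "e \<in> monoid_span B"
  shows "\<exists>c. e = (\<Sum>u\<in>B. multiple (c u) u)"
  using assms(2)
proof induction
  case monoid_span_zero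
  show ?case by (rule exI [of _ "\<lambda>_. 0"]) simp
next
  case (monoid_span_gen_add v e)
  then obtain c where c: "e = (\<Sum>u\<in>B. multiple (c u) u)" by blast
  have "(\<Sum>u\<in>B. multiple ((c(v := Suc (c v))) u) u)
      = multiple (Suc (c v)) v + (\<Sum>u\<in>B - {v}. multiple (c u) u)"
    using assms(1) monoid_span_gen_add(1) by (simp add: sum.remove)
  also have "\<dots> = v + e"
    using assms(1) monoid_span_gen_add(1) by (simp add: c sum.remove multiple_Suc add.assoc)
  finally show ?case by metis
qed

text \<open>The usual normality in the group of differences: if \<open>x = a - b\<close> and
  \<open>c * x\<close> lies in \<open>M\<close> for some \<open>c > 0\<close>, then \<open>x\<close>
  lies in \<open>M\<close>. The relations are written additively because subtraction of naturals
  truncates.\<close>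

definition normal_monoid :: "('v \<Rightarrow>\<^sub>0 nat) set \<Rightarrow> bool" where
  "normal_monoid M \<longleftrightarrow>
     (\<forall>a\<in>M. \<forall>b\<in>M. \<forall>m\<in>M. \<forall>c>0. multiple c a = m + multiple c b \<longrightarrow> (\<exists>r\<in>M. a = r + b))"

text \<open>Put \<open>x = a - b\<close>, so that \<open>m k = d + k * x\<close>. Two of the
  \<open>m k\<close> have comparable coefficient vectors, and in their difference \<open>d\<close>
  cancels, leaving \<open>(j - i) * x\<close>. Nothing forces \<open>d\<close> itself to lie in the
  monoid.\<close>

lemma normal_monoid_almost_integral:
  fixes a b d :: "'v \<Rightarrow>\<^sub>0 nat"
  assumes "finite B" and norm: "normal_monoid (monoid_span B)"
    and ab: "a \<in> monoid_span B" "b \<in> monoid_span B"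
    and ex: "\<And>k. \<exists>m\<in>monoid_span B. d + multiple k a = m + multiple k b"
  shows "\<exists>r\<in>monoid_span B. a = r + b"
proof -
  obtain m where m: "\<And>k. m k \<in> monoid_span B" "\<And>k. d + multiple k a = m k + multiple k b"
    using ex by metis
  obtain \<gamma> where \<gamma>: "\<And>k. m k = (\<Sum>u\<in>B. multiple (\<gamma> k u) u)"
    using monoid_span_imp_combination [OF assms(1) m(1)] by metis
  obtain i j where ij: "i < j" "\<forall>u\<in>B. \<gamma> i u \<le> \<gamma> j u"
    using dickson [OF assms(1), of \<gamma>] .
  \<comment> \<open>The difference \<open>m j - m i\<close> is formed on coefficients rather than
    exponents, which keeps it inside the monoid.\<close>
  define e where "e = (\<Sum>u\<in>B. multiple (\<gamma> j u - \<gamma> i u) u)"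
  have e: "e \<in> monoid_span B"
    unfolding e_def by (intro monoid_span_sum monoid_span_multiple monoid_span_gen)
  have split: "m j = m i + e"
    unfolding \<gamma> e_def sum.distrib [symmetric] using ij(2)
    by (intro sum.cong refl poly_mapping_eqI) (simp add: lookup_add add_mult_distrib [symmetric])
  have "multiple (j - i) a = e + multiple (j - i) b"
  proof (rule poly_mapping_eqI)
    fix x
    let ?l = "\<lambda>p::'v \<Rightarrow>\<^sub>0 nat. Poly_Mapping.lookup p x"
    have "?l d + j * ?l a = ?l (m i) + ?l e + j * ?l b"
      using arg_cong [OF m(2) [of j], of ?l] by (simp add: split lookup_add)
    moreover have "?l d + i * ?l a = ?l (m i) + i * ?l b"
      using arg_cong [OF m(2) [of i], of ?l] by (simp add: lookup_add)
    moreover have "j = i + (j - i)"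
      using ij(1) by simp
    then have "j * y = i * y + (j - i) * y" for y
      by (metis add_mult_distrib)
    ultimately show "?l (multiple (j - i) a) = ?l (e + multiple (j - i) b)"
      by (simp add: lookup_add)
  qed
  then show ?thesis
    using norm ab e ij(1) unfolding normal_monoid_def by (meson zero_less_diff)
qed

section \<open>Monoid algebras\<close>

lemma monom_0: "monom 0 = 1"
  by (simp add: monom_def)

lemma monom_add: "monom (a + b) = monom a * monom b"
  by (simp add: monom_def mult_single)

lemma monom_power: "monom a ^ c = monom (multiple c a)"
  by (induction c) (simp_all add: monom_0 monom_add multiple_Suc)

lemma monom_in_kalg: "e \<in> monoid_span B \<Longrightarrow> monom e \<in> kalg B"
proof (induction rule: monoid_span.induct)
  case monoid_span_zero
  show ?case using kalg_const [of 1 B] by (simp add: const_def monom_def)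
next
  case (monoid_span_gen_add u e)
  then show ?case by (simp add: monom_add kalg_gen kalg_mult)
qed

text \<open>Products of generators are exactly the monomials with exponent in the monoid, and these
  span the algebra over K. Membership thus becomes a condition on the support.\<close>

lemma kalg_eq: "kalg B = {p :: ('v, 'k::field) mpoly. Poly_Mapping.keys p \<subseteq> monoid_span B}"
proof (rule set_eqI, rule iffI)
  fix p :: "('v, 'k) mpoly"
  assume "p \<in> kalg B"
  then have "Poly_Mapping.keys p \<subseteq> monoid_span B"
  proof induction
    case (kalg_const c)
    show ?case by (auto simp: const_def intro: monoid_span_zero)
  next
    case (kalg_gen u)
    then show ?case by (simp add: monom_def monoid_span_gen)
  next
    case (kalg_add p q)
    then show ?case using keys_add [of p q] by blast
  next
    case (kalg_mult p q)
    show ?case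
    proof
      fix e assume "e \<in> Poly_Mapping.keys (p * q)"
      then obtain a b where "a \<in> Poly_Mapping.keys p" "b \<in> Poly_Mapping.keys q" "e = a + b"
        using keys_mult by fast
      then show "e \<in> monoid_span B"
        using kalg_mult.IH by (blast intro: monoid_span_add)
    qed
  qed
  then show "p \<in> {p. Poly_Mapping.keys p \<subseteq> monoid_span B}"
    by simp
next
  fix p :: "('v, 'k) mpoly"
  assume "p \<in> {p. Poly_Mapping.keys p \<subseteq> monoid_span B}"
  then have "Poly_Mapping.keys p \<subseteq> monoid_span B" by simp
  then show "p \<in> kalg B"
  proof (induction p rule: update_induct)
    case const
    show ?case using kalg_const [of 0 B] by (simp add: const_def)
  next
    case (update f a b)
    have "Poly_Mapping.update a b f = f + const b * monom a"
      using update.hyps(1)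
      by (intro poly_mapping_eqI)
         (auto simp: lookup_update lookup_add lookup_single in_keys_iff when_def
            const_def monom_def mult_single)
    moreover have "f \<in> kalg B" "a \<in> monoid_span B"
      using update by (simp_all add: keys_update)
    ultimately show ?case
      by (simp add: kalg_add kalg_mult kalg_const monom_in_kalg)
  qed
qed

lemma kalg_uminus: "p \<in> kalg B \<Longrightarrow> - p \<in> kalg B"
  by (simp add: kalg_eq)

lemma kalg_diff: "p \<in> kalg B \<Longrightarrow> q \<in> kalg B \<Longrightarrow> p - q \<in> kalg B"
  using kalg_add [of p B "- q"] kalg_uminus [of q B] by simp

lemma kalg_0: "0 \<in> kalg B"
  by (simp add: kalg_eq)

lemma kalg_power: "p \<in> kalg B \<Longrightarrow> p ^ c \<in> kalg B"
proof (induction c)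
  case 0
  show ?case using kalg_const [of 1 B] by (simp add: const_def)
qed (simp add: kalg_mult)

lemma kalg_sum: "(\<And>i. i \<in> I \<Longrightarrow> f i \<in> kalg B) \<Longrightarrow> sum f I \<in> kalg B"
  by (induction I rule: infinite_finite_induct) (auto intro: kalg_0 kalg_add)

section \<open>Leading exponents\<close>

definition lead :: "('e::linorder \<Rightarrow>\<^sub>0 'k::zero) \<Rightarrow> 'e" where
  "lead p = Max (Poly_Mapping.keys p)"

lemma lead_in_keys: "p \<noteq> 0 \<Longrightarrow> lead p \<in> Poly_Mapping.keys p"
  unfolding lead_def by (metis Max_in finite_keys lookup_not_eq_zero_eq_in_keys
      lookup_zero poly_mapping_eqI empty_iff)

lemma le_lead: "e \<in> Poly_Mapping.keys p \<Longrightarrow> e \<le> lead p"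
  by (simp add: lead_def)

text \<open>With the leading terms split off, every other product of terms has a strictly smaller
  exponent, so nothing can cancel at \<open>lead p + lead q\<close>.\<close>

lemma lookup_mult_lead:
  fixes p q :: "'e::{ordered_cancel_comm_monoid_add, linorder} \<Rightarrow>\<^sub>0 'k::idom"
  shows "Poly_Mapping.lookup (p * q) (lead p + lead q)
       = Poly_Mapping.lookup p (lead p) * Poly_Mapping.lookup q (lead q)"
proof -
  define tail :: "('e \<Rightarrow>\<^sub>0 'k) \<Rightarrow> ('e \<Rightarrow>\<^sub>0 'k)"
    where "tail r = r - Poly_Mapping.single (lead r) (Poly_Mapping.lookup r (lead r))" for r
  have tail: "e < lead r" if "e \<in> Poly_Mapping.keys (tail r)" for e r
    using that le_lead [of e r]
    by (cases "e = lead r") (auto simp: tail_def in_keys_iff lookup_minus lookup_single when_def)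
  let ?P = "Poly_Mapping.single (lead p) (Poly_Mapping.lookup p (lead p))"
  let ?Q = "Poly_Mapping.single (lead q) (Poly_Mapping.lookup q (lead q))"
  have "p * q = ?P * ?Q + ?P * tail q + tail p * q"
    by (simp add: tail_def algebra_simps)
  moreover have "lead p + lead q \<notin> Poly_Mapping.keys (?P * tail q)"
  proof
    assume "lead p + lead q \<in> Poly_Mapping.keys (?P * tail q)"
    then obtain a b where "a \<in> Poly_Mapping.keys ?P" "b \<in> Poly_Mapping.keys (tail q)"
      and eq: "lead p + lead q = a + b"
      using keys_mult by fast
    then have "a = lead p" "b < lead q"
      using tail by (auto split: if_splits)
    then show False using eq by simp
  qed
  moreover have "lead p + lead q \<notin> Poly_Mapping.keys (tail p * q)"
  proof
    assume "lead p + lead q \<in> Poly_Mapping.keys (tail p * q)"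
    then obtain a b where "a \<in> Poly_Mapping.keys (tail p)" "b \<in> Poly_Mapping.keys q"
      and eq: "lead p + lead q = a + b"
      using keys_mult by fast
    then have "a + b < lead p + lead q"
      by (intro add_less_le_mono tail le_lead)
    then show False using eq by simp
  qed
  ultimately show ?thesis
    by (simp add: lookup_add mult_single in_keys_iff)
qed

lemma lead_mult:
  fixes p q :: "'e::{ordered_cancel_comm_monoid_add, linorder} \<Rightarrow>\<^sub>0 'k::idom"
  assumes "p \<noteq> 0" "q \<noteq> 0"
  shows "lead (p * q) = lead p + lead q"
  unfolding lead_def [of "p * q"]
proof (rule Max_eqI)
  fix e
  assume "e \<in> Poly_Mapping.keys (p * q)"
  then obtain a b where "a \<in> Poly_Mapping.keys p" "b \<in> Poly_Mapping.keys q" "e = a + b"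
    using keys_mult by fast
  then show "e \<le> lead p + lead q"
    by (auto intro: add_mono le_lead)
next
  show "lead p + lead q \<in> Poly_Mapping.keys (p * q)"
    using assms lead_in_keys by (auto simp: in_keys_iff lookup_mult_lead)
qed simp

lemma lead_power:
  fixes p :: "('v::linorder \<Rightarrow>\<^sub>0 nat) \<Rightarrow>\<^sub>0 'k::idom"
  assumes "p \<noteq> 0"
  shows "lead (p ^ c) = multiple c (lead p)"
  using assms by (induction c) (simp_all add: lead_mult multiple_Suc lead_def [of 1])

section \<open>Almost integral fractions and division\<close>

text \<open>All powers of an integral fraction \<open>a / b\<close> share the denominator
  \<open>b ^ n\<close>: this is clear up to exponent \<open>n\<close>, and the integral equation
  reduces higher powers to lower ones.\<close>

lemma integral_fraction_common_denominator:
  fixes a b :: "'a::idom"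
  assumes R: "\<And>x y. x \<in> R \<Longrightarrow> y \<in> R \<Longrightarrow> x * y \<in> R" "\<And>x. x \<in> R \<Longrightarrow> - x \<in> R"
      "\<And>f (I :: nat set). (\<And>i. i \<in> I \<Longrightarrow> f i \<in> R) \<Longrightarrow> sum f I \<in> R" "\<And>x (k::nat). x \<in> R \<Longrightarrow> x ^ k \<in> R"
    and ab: "a \<in> R" "b \<in> R" and c: "\<And>i. i < n \<Longrightarrow> c i \<in> R"
    and eq: "a ^ n + (\<Sum>i<n. c i * a ^ i * b ^ (n - i)) = 0"
  shows "\<exists>r\<in>R. b ^ n * a ^ k = r * b ^ k"
proof (induction k rule: less_induct)
  case (less k)
  show ?case
  proof (cases "k \<le> n")
    case True
    then have "b ^ n * a ^ k = (b ^ (n - k) * a ^ k) * b ^ k"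
      by (metis (no_types, lifting) le_add_diff_inverse2 mult.assoc mult.commute power_add)
    then show ?thesis
      by (intro bexI [of _ "b ^ (n - k) * a ^ k"] R(1) R(4) ab)
  next
    case False
    \<comment> \<open>Multiplying the integral equation by \<open>a ^ (k - n)\<close> leaves only
      the powers \<open>i + (k - n)\<close> with \<open>i < n\<close>, all below
      \<open>k\<close>.\<close>
    have "\<forall>i<n. \<exists>r\<in>R. b ^ n * a ^ (i + (k - n)) = r * b ^ (i + (k - n))"
      using less False by simp
    then obtain r where r: "\<And>i. i < n \<Longrightarrow> r i \<in> R"
      "\<And>i. i < n \<Longrightarrow> b ^ n * a ^ (i + (k - n)) = r i * b ^ (i + (k - n))"
      by metis
    have "a ^ n = - (\<Sum>i<n. c i * a ^ i * b ^ (n - i))"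
      using eq by (simp add: eq_neg_iff_add_eq_0)
    moreover have "a ^ k = a ^ n * a ^ (k - n)"
      using False by (simp add: power_add [symmetric])
    ultimately have "b ^ n * a ^ k
        = - (\<Sum>i<n. c i * (b ^ n * a ^ (i + (k - n))) * b ^ (n - i))"
      by (simp add: sum_distrib_left sum_distrib_right power_add mult_ac)
    also have "\<dots> = - (\<Sum>i<n. c i * r i * b ^ k)"
    proof (intro arg_cong [of _ _ uminus] sum.cong refl)
      fix i assume "i \<in> {..<n}"
      then have "b ^ k = b ^ (i + (k - n)) * b ^ (n - i)" "i < n"
        using False by (simp_all add: power_add [symmetric])
      then show "c i * (b ^ n * a ^ (i + (k - n))) * b ^ (n - i) = c i * r i * b ^ k"
        using r(2) by (simp add: mult_ac)
    qed
    finally have "b ^ n * a ^ k = - (\<Sum>i<n. c i * r i) * b ^ k"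
      by (simp add: sum_distrib_right)
    moreover have "- (\<Sum>i<n. c i * r i) \<in> R"
      by (intro R(1-3) c r(1)) simp_all
    ultimately show ?thesis by blast
  qed
qed

text \<open>Long division by \<open>g\<close>, by induction on \<open>lead f\<close>. Normality of
  the monoid makes the leading term of \<open>f\<close> divisible by that of \<open>g\<close> within
  the algebra, and the remainder is again almost integral with the same \<open>d\<close>.\<close>

lemma monoid_algebra_almost_integral:
  fixes f g d :: "('v::linorder, 'k::field) mpoly"
  assumes fin: "finite B" and norm: "normal_monoid (monoid_span B)"
    and g: "g \<in> kalg B" "g \<noteq> 0" and d: "d \<noteq> 0"
    and "f \<in> kalg B" and "\<And>k. \<exists>r\<in>kalg B. d * f ^ k = r * g ^ k"
  shows "\<exists>r\<in>kalg B. f = r * g"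
proof -
  \<comment> \<open>The finitely many variables occurring in \<open>B\<close>; all leading exponents
    live over them, so \<open>wf_exponents\<close> applies.\<close>
  define V where "V = (\<Union>u\<in>B. Poly_Mapping.keys u)"
  have V: "finite V" using fin by (simp add: V_def)
  have keys_V: "Poly_Mapping.keys e \<subseteq> V" if "e \<in> monoid_span B" for e
    using that by induction (auto simp: keys_add_nat V_def)
  have "\<forall>f::('v, 'k) mpoly. lead f = e \<longrightarrow> f \<in> kalg B \<longrightarrow>
      (\<forall>k. \<exists>r\<in>kalg B. d * f ^ k = r * g ^ k) \<longrightarrow> (\<exists>r\<in>kalg B. f = r * g)" for e
  proof (induction e rule: wf_induct_rule [OF wf_exponents [OF V]])
    case (1 e)
    show ?case
    proof (intro allI impI)
      fix f :: "('v, 'k) mpoly"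
      assume e: "lead f = e" and f: "f \<in> kalg B"
        and ex: "\<forall>k. \<exists>r\<in>kalg B. d * f ^ k = r * g ^ k"
      show "\<exists>r\<in>kalg B. f = r * g"
      proof (cases "f = 0")
        case True
        then show ?thesis using kalg_0 by (metis mult_zero_left)
      next
        case f0: False
        have lead_span: "lead p \<in> monoid_span B" if "p \<in> kalg B" "p \<noteq> 0" for p :: "('v, 'k) mpoly"
          using that lead_in_keys [of p] by (auto simp: kalg_eq)
        \<comment> \<open>Since \<open>lead\<close> turns products into sums, the relation between
          polynomials becomes one between exponents, with \<open>m = lead r\<close>.\<close>
        have "\<exists>m\<in>monoid_span B. lead d + multiple k (lead f) = m + multiple k (lead g)" for k
        proof -
          obtain r where r: "r \<in> kalg B" "d * f ^ k = r * g ^ k" using ex by blast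
          then have "r \<noteq> 0" using d f0 by auto
          then show ?thesis
            using arg_cong [OF r(2), of lead] d f0 g(2) lead_span [OF r(1)]
            by (auto simp: lead_mult lead_power)
        qed
        then obtain u where u: "u \<in> monoid_span B" "lead f = u + lead g"
          using normal_monoid_almost_integral [OF fin norm lead_span [OF f f0] lead_span [OF g]]
          by blast
        \<comment> \<open>The quotient of the leading terms of \<open>f\<close> and
          \<open>g\<close>, so that \<open>t * g\<close> has the same leading term as
          \<open>f\<close>.\<close>
        define t where "t = Poly_Mapping.single u
          (Poly_Mapping.lookup f (lead f) / Poly_Mapping.lookup g (lead g))"
        have lc0: "Poly_Mapping.lookup f (lead f) \<noteq> 0" "Poly_Mapping.lookup g (lead g) \<noteq> 0"
          using lead_in_keys f0 g(2) by (auto simp: in_keys_iff)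
        have t0: "t \<noteq> 0" and lead_t: "lead t = u"
          and lc_t: "Poly_Mapping.lookup t u
            = Poly_Mapping.lookup f (lead f) / Poly_Mapping.lookup g (lead g)"
          using lc0 by (auto simp: t_def lead_def dest!: arg_cong [of _ 0 "\<lambda>p. Poly_Mapping.lookup p u"])
        have t: "t \<in> kalg B"
          using u(1) by (auto simp: kalg_eq t_def)
        define h where "h = f - t * g"
        have h: "h \<in> kalg B"
          unfolding h_def by (intro kalg_diff kalg_mult f t g)
        \<comment> \<open>Substituting \<open>h = f - t * g\<close> for one factor \<open>h\<close>
          gives two products with \<open>j\<close> factors \<open>h\<close>, one of them with an
          extra \<open>f\<close>. Hence \<open>i\<close> must be arbitrary in the induction; the
          case \<open>i = 0\<close> is the one wanted.\<close>
        have mixed: "\<exists>r\<in>kalg B. d * f ^ i * h ^ j = r * g ^ (i + j)" for i j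
        proof (induction j arbitrary: i)
          case 0
          show ?case using ex by simp
        next
          case (Suc j)
          obtain r where r: "r \<in> kalg B" "d * f ^ Suc i * h ^ j = r * g ^ (Suc i + j)"
            using Suc [of "Suc i"] by blast
          obtain s where s: "s \<in> kalg B" "d * f ^ i * h ^ j = s * g ^ (i + j)"
            using Suc [of i] by blast
          have "d * f ^ i * h ^ Suc j = d * f ^ Suc i * h ^ j - t * g * (d * f ^ i * h ^ j)"
            by (simp add: h_def algebra_simps)
          also have "\<dots> = (r - t * s) * g ^ (i + Suc j)"
            unfolding r(2) s(2) by (simp add: algebra_simps)
          finally show ?case
            using r(1) s(1) t by (blast intro: kalg_diff kalg_mult)
        qed
        then have h_ex: "\<forall>k. \<exists>r\<in>kalg B. d * h ^ k = r * g ^ k"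
          using mixed [of 0] by simp
        have "\<exists>r\<in>kalg B. h = r * g"
        proof (cases "h = 0")
          case True
          then show ?thesis using kalg_0 by (metis mult_zero_left)
        next
          case h0: False
          have lead_tg: "lead (t * g) = lead f"
            using t0 g(2) by (simp add: lead_mult lead_t u(2))
          have "lead h \<in> Poly_Mapping.keys f \<union> Poly_Mapping.keys (t * g)"
            using lead_in_keys [OF h0] by (auto simp: h_def in_keys_iff lookup_minus)
          then have "lead h \<le> lead f"
            using le_lead [of "lead h" f] le_lead [of "lead h" "t * g"] lead_tg by auto
          \<comment> \<open>The coefficients at \<open>lead f\<close> cancel in \<open>h\<close>,
            which makes its leading exponent strictly smaller.\<close>
          moreover have "Poly_Mapping.lookup (t * g) (lead f) = Poly_Mapping.lookup f (lead f)"
            using lookup_mult_lead [of t g] lc0(2) by (simp add: lead_t lc_t u(2))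
          then have "lead h \<noteq> lead f"
            using lead_in_keys [OF h0] by (auto simp: h_def in_keys_iff lookup_minus)
          ultimately have "(lead h, e) \<in> {(a, b). a < b \<and> Poly_Mapping.keys a \<subseteq> V \<and>
                     Poly_Mapping.keys b \<subseteq> V}"
            using keys_V [OF lead_span [OF h h0]] keys_V [OF lead_span [OF f f0]] e by auto
          then show ?thesis using 1 h h_ex by blast
        qed
        then obtain r where "r \<in> kalg B" "h = r * g" by blast
        then have "r + t \<in> kalg B" "f = (r + t) * g"
          using t by (auto simp: h_def algebra_simps intro: kalg_add)
        then show ?thesis by blast
      qed
    qed
  qed
  then show ?thesis using assms by blast
qed

text \<open>From ring to monoid, a monoid relation is read as an integral equation between
  monomials. Conversely, an integral fraction is almost integral, and division applies.\<close>

theorem normal_kalg_iff: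
  fixes B :: "('v::linorder \<Rightarrow>\<^sub>0 nat) set"
  assumes "finite B"
  shows "normal_subring (kalg B :: ('v, 'k::field) mpoly set) \<longleftrightarrow> normal_monoid (monoid_span B)"
proof
  assume norm: "normal_subring (kalg B :: ('v, 'k) mpoly set)"
  show "normal_monoid (monoid_span B)"
    unfolding normal_monoid_def
  proof (intro ballI allI impI)
    fix a b m and c :: nat
    assume abm: "a \<in> monoid_span B" "b \<in> monoid_span B" "m \<in> monoid_span B"
      and c: "0 < c" and eq: "multiple c a = m + multiple c b"
    \<comment> \<open>Coefficients of the equation \<open>T ^ c - monom m = 0\<close> for the
      fraction \<open>monom a / monom b\<close>. Index 0 is in range because
      \<open>c > 0\<close>.\<close>
    define q :: "nat \<Rightarrow> ('v, 'k) mpoly" where "q i = (if i = 0 then - monom m else 0)" for i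
    have "(\<Sum>i<c. q i * monom a ^ i * monom b ^ (c - i)) = (\<Sum>i\<in>{0}. q i * monom a ^ i * monom b ^ (c - i))"
      using c by (intro sum.mono_neutral_right) (auto simp: q_def)
    also have "\<dots> = - monom (multiple c a)"
      by (simp add: q_def eq monom_add monom_power)
    finally have "monom a ^ c + (\<Sum>i<c. q i * monom a ^ i * monom b ^ (c - i)) = 0"
      by (simp add: monom_power)
    moreover have "\<forall>i<c. q i \<in> kalg B"
      using abm by (auto simp: q_def intro: kalg_0 kalg_uminus monom_in_kalg)
    moreover have "monom b \<noteq> (0 :: ('v, 'k) mpoly)"
      by (auto simp: monom_def dest!: arg_cong [of _ 0 "\<lambda>p. Poly_Mapping.lookup p b"])
    moreover have "monom a \<in> (kalg B :: ('v, 'k) mpoly set)" "monom b \<in> (kalg B :: ('v, 'k) mpoly set)"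
      using abm by (auto intro: monom_in_kalg)
    ultimately obtain r :: "('v, 'k) mpoly" where r: "r \<in> kalg B" "monom a = r * monom b"
      using norm c unfolding normal_subring_def by blast
    \<comment> \<open>Only a term of \<open>r\<close> with exponent \<open>x\<close> satisfying
      \<open>x + b = a\<close> can produce \<open>monom a\<close>, and every exponent of
      \<open>r\<close> lies in the monoid.\<close>
    have "a \<in> Poly_Mapping.keys (r * monom b)"
      unfolding r(2) [symmetric] by (simp add: monom_def)
    then obtain x where "x \<in> Poly_Mapping.keys r" "a = x + b"
      using keys_mult [of r "monom b"] by (auto simp: monom_def)
    then show "\<exists>r\<in>monoid_span B. a = r + b"
      using r(1) by (auto simp: kalg_eq)
  qed
next
  assume norm: "normal_monoid (monoid_span B)"
  show "normal_subring (kalg B :: ('v, 'k) mpoly set)"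
    unfolding normal_subring_def
  proof (intro ballI impI)
    fix a b :: "('v, 'k) mpoly"
    assume ab: "a \<in> kalg B" "b \<in> kalg B" and b0: "b \<noteq> 0"
      and "\<exists>n>0. \<exists>c. (\<forall>i<n. c i \<in> kalg B) \<and> a ^ n + (\<Sum>i<n. c i * a ^ i * b ^ (n - i)) = 0"
    then obtain n c where c: "\<And>i. i < n \<Longrightarrow> c i \<in> kalg B"
      and eq: "a ^ n + (\<Sum>i<n. c i * a ^ i * b ^ (n - i)) = 0"
      by blast
    have "\<exists>r\<in>kalg B. b ^ n * a ^ k = r * b ^ k" for k
      by (rule integral_fraction_common_denominator
            [OF kalg_mult kalg_uminus kalg_sum kalg_power ab c eq])
    then show "\<exists>r\<in>kalg B. a = r * b"
      using monoid_algebra_almost_integral [OF assms norm ab(2) b0 _ ab(1), of "b ^ n"] b0 by simp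
  qed
qed

section \<open>The map pi and polarized monoids\<close>

lemma pi_map_0 [simp]: "pi_map 0 = 0"
  by (simp add: pi_map_def)

lemma pi_map_add: "pi_map (v + w) = pi_map v + pi_map w"
  unfolding pi_map_def by (rule setsum_keys_plus_distrib) (simp_all add: single_add)

lemma pi_map_single [simp]: "pi_map (Poly_Mapping.single p c) = Poly_Mapping.single (fst p) c"
  by (simp add: pi_map_def)

lemma pi_map_multiple: "pi_map (multiple c w) = multiple c (pi_map w)"
  by (induction c) (simp_all add: multiple_Suc pi_map_add)

text \<open>The exponent of x_i in the image is the sum of the exponents of all x_ij. This gives
  both the trivial kernel of \<open>pi_map\<close> and the finiteness of polarizations.\<close>

lemma lookup_le_pi_map: "Poly_Mapping.lookup w p \<le> Poly_Mapping.lookup (pi_map w) (fst p)"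
  by (induction w rule: exponent_induct)
     (auto simp: pi_map_add lookup_add lookup_single when_def)

lemma pi_map_eq_0_iff: "pi_map w = 0 \<longleftrightarrow> w = 0"
  using lookup_le_pi_map [of w] by (auto intro: poly_mapping_eqI)

lemma exponent_minus_single:
  fixes u :: "'v \<Rightarrow>\<^sub>0 nat"
  assumes "Poly_Mapping.lookup u i > 0"
  obtains u' where "u = u' + Poly_Mapping.single i 1"
proof
  show "u = (u - Poly_Mapping.single i 1) + Poly_Mapping.single i 1"
    using assms
    by (intro poly_mapping_eqI) (auto simp: lookup_add lookup_minus lookup_single when_def)
qed

text \<open>Riesz decomposition: a factorization of the image lifts. Each variable of
  \<open>s\<close> is assigned to one factor: its image x_i divides \<open>u\<close> or
  \<open>v\<close>, is removed there, and the variable joins the corresponding part.\<close>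

lemma pi_map_split:
  "pi_map s = u + v \<Longrightarrow> \<exists>s1 s2. s = s1 + s2 \<and> pi_map s1 = u \<and> pi_map s2 = v"
proof (induction s arbitrary: u v rule: exponent_induct)
  case zero
  then have "u = 0 \<and> v = 0"
    by (auto simp: poly_mapping_eq_iff fun_eq_iff lookup_add)
  then show ?case by (intro exI [of _ 0]) simp
next
  case (add_single s p)
  have eq: "pi_map s + Poly_Mapping.single (fst p) 1 = u + v"
    using add_single.prems by (simp add: pi_map_add)
  from arg_cong [OF this, of "\<lambda>e. Poly_Mapping.lookup e (fst p)"]
  consider "Poly_Mapping.lookup u (fst p) > 0" | "Poly_Mapping.lookup v (fst p) > 0"
    by (fastforce simp: lookup_add)
  then show ?case
  proof cases
    case 1
    then obtain u' where u': "u = u' + Poly_Mapping.single (fst p) 1"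
      by (rule exponent_minus_single)
    then have "pi_map s + Poly_Mapping.single (fst p) 1 = (u' + v) + Poly_Mapping.single (fst p) 1"
      using eq by (simp add: add_ac)
    then have "pi_map s = u' + v"
      by (rule add_right_imp_eq)
    then obtain s1 s2 where "s = s1 + s2" "pi_map s1 = u'" "pi_map s2 = v"
      using add_single.IH by blast
    then show ?thesis
      by (intro exI [of _ "s1 + Poly_Mapping.single p 1"] exI [of _ s2])
         (simp add: pi_map_add u' add_ac)
  next
    case 2
    then obtain v' where v': "v = v' + Poly_Mapping.single (fst p) 1"
      by (rule exponent_minus_single)
    then have "pi_map s = u + v'"
      using eq by (simp add: add.assoc [symmetric])
    then obtain s1 s2 where "s = s1 + s2" "pi_map s1 = u" "pi_map s2 = v'"
      using add_single.IH by blast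
    then show ?thesis
      by (intro exI [of _ s1] exI [of _ "s2 + Poly_Mapping.single p 1"])
         (simp add: pi_map_add v' add_ac)
  qed
qed

section \<open>Polarized monoids\<close>

lemma finite_polarize:
  assumes "finite A"
  shows "finite (polarize n k A)"
proof -
  let ?V = "{(i, j). 1 \<le> i \<and> i \<le> n \<and> 1 \<le> j \<and> j \<le> k i}"
  have "?V = (SIGMA i:{1..n}. {1..k i})" by auto
  then have V: "finite ?V" by simp
  \<comment> \<open>A bound for all exponents in \<open>A\<close>. If \<open>A\<close> is empty or
    \<open>n = 0\<close>, this \<open>Max\<close> is unspecified, but then \<open>N\<close> bounds
    nothing.\<close>
  define N where "N = Max (case_prod Poly_Mapping.lookup ` (A \<times> {1..n}))"
  have N: "Poly_Mapping.lookup u i \<le> N" if "u \<in> A" "i \<in> {1..n}" for u i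
    unfolding N_def using that assms by (intro Max_ge) auto
  have "Poly_Mapping.lookup ` polarize n k A
      \<subseteq> {f. \<forall>p. (p \<in> ?V \<longrightarrow> f p \<in> {..N}) \<and> (p \<notin> ?V \<longrightarrow> f p = 0)}"
  proof (intro image_subsetI CollectI allI conjI impI)
    fix w p
    assume "w \<in> polarize n k A"
    then have w: "Poly_Mapping.keys w \<subseteq> ?V" "pi_map w \<in> A"
      by (simp_all add: polarize_def)
    show "Poly_Mapping.lookup w p \<in> {..N}" if "p \<in> ?V"
      using N [OF w(2), of "fst p"] lookup_le_pi_map [of w p] that by auto
    show "Poly_Mapping.lookup w p = 0" if "p \<notin> ?V"
      using w(1) that by (subst not_in_keys_iff_lookup_eq_zero [symmetric]) blast
  qed
  then have "finite (Poly_Mapping.lookup ` polarize n k A)"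
    by (rule finite_subset) (rule finite_set_of_finite_funs [OF V], simp)
  then show ?thesis
    by (rule finite_imageD) (intro inj_onI poly_mapping_eqI, simp)
qed

text \<open>For the inclusion from right to left, generators of \<open>A\<close> are peeled off the
  image and lifted by \<open>pi_map_split\<close>. The base case holds because only 0 maps to
  0.\<close>

lemma monoid_span_polarize:
  "monoid_span (polarize n k A)
     = {s. Poly_Mapping.keys s \<subseteq> {(i, j). 1 \<le> i \<and> i \<le> n \<and> 1 \<le> j \<and> j \<le> k i} \<and>
           pi_map s \<in> monoid_span A}" (is "_ = {s. Poly_Mapping.keys s \<subseteq> ?V \<and> _}")
proof (intro equalityI subsetI CollectI)
  fix s
  assume "s \<in> monoid_span (polarize n k A)"
  then show "Poly_Mapping.keys s \<subseteq> ?V \<and> pi_map s \<in> monoid_span A"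
    by induction (auto simp: polarize_def keys_add_nat pi_map_add intro: monoid_span.intros)
next
  have "s \<in> monoid_span (polarize n k A)"
    if "e \<in> monoid_span A" "pi_map s = e" "Poly_Mapping.keys s \<subseteq> ?V" for e s
    using that
  proof (induction arbitrary: s)
    case monoid_span_zero
    then show ?case by (simp add: pi_map_eq_0_iff monoid_span.monoid_span_zero)
  next
    case (monoid_span_gen_add u e)
    obtain s1 s2 where s: "s = s1 + s2" "pi_map s1 = u" "pi_map s2 = e"
      using pi_map_split [OF monoid_span_gen_add.prems(1)] by blast
    then have "s1 \<in> polarize n k A" "s2 \<in> monoid_span (polarize n k A)"
      using monoid_span_gen_add by (auto simp: polarize_def keys_add_nat)
    then show ?case
      unfolding s(1) by (rule monoid_span.monoid_span_gen_add)
  qed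
  then show "s \<in> monoid_span (polarize n k A)"
    if "s \<in> {s. Poly_Mapping.keys s \<subseteq> ?V \<and> pi_map s \<in> monoid_span A}" for s
    using that by blast
qed

section \<open>An additive section of pi and transfer of normality\<close>

text \<open>Sends x_i to x_i1; the second index 1 is always available since
  \<open>k i \<ge> 1\<close>.\<close>

lift_definition pi_section :: "(nat \<Rightarrow>\<^sub>0 nat) \<Rightarrow> (nat \<times> nat \<Rightarrow>\<^sub>0 nat)"
  is "\<lambda>f p. f (fst p) when snd p = 1"
proof -
  fix f :: "nat \<Rightarrow> nat"
  assume "finite {i. f i \<noteq> 0}"
  then have "finite ({i. f i \<noteq> 0} \<times> {1::nat})" by simp
  then show "finite {p. (f (fst p) when snd p = (1::nat)) \<noteq> 0}"
    by (rule rev_finite_subset) (auto simp: when_def split: if_splits)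
qed

lemma pi_section_add: "pi_section (a + b) = pi_section a + pi_section b"
  by (intro poly_mapping_eqI) (simp add: pi_section.rep_eq lookup_add when_def)

lemma pi_section_multiple: "pi_section (multiple c a) = multiple c (pi_section a)"
  by (intro poly_mapping_eqI) (simp add: pi_section.rep_eq when_def)

lemma keys_pi_section: "Poly_Mapping.keys (pi_section a) = Poly_Mapping.keys a \<times> {1}"
  by (auto simp: in_keys_iff pi_section.rep_eq when_def split: if_splits)

lemma pi_map_pi_section: "pi_map (pi_section a) = a"
proof (induction a rule: exponent_induct)
  case zero
  have "pi_section 0 = 0"
    by (intro poly_mapping_eqI) (simp add: pi_section.rep_eq)
  then show ?case by simp
next
  case (add_single a i)
  have "pi_section (Poly_Mapping.single i 1) = Poly_Mapping.single (i, 1) 1"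
    by (intro poly_mapping_eqI) (auto simp: pi_section.rep_eq lookup_single when_def)
  then show ?case using add_single by (simp add: pi_section_add pi_map_add)
qed

text \<open>Relations over \<open>A\<close> are moved up by \<open>pi_section\<close> and their
  solutions back by \<open>pi_map\<close>. In the other direction \<open>pi_map\<close> moves
  relations down, and the preimage description puts \<open>a - b\<close> itself into the polarized
  monoid.\<close>

lemma normal_monoid_span_polarize_iff:
  assumes k: "\<forall>i\<in>{1..n}. k i \<ge> 1" and A: "A \<subseteq> monomials_S n"
  shows "normal_monoid (monoid_span (polarize n k A)) \<longleftrightarrow> normal_monoid (monoid_span A)"
proof
  assume norm: "normal_monoid (monoid_span (polarize n k A))"
  have keys: "Poly_Mapping.keys e \<subseteq> {1..n}" if "e \<in> monoid_span A" for e
    using that by induction (use A in \<open>auto simp: keys_add_nat monomials_S_def\<close>)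
  have sec: "pi_section e \<in> monoid_span (polarize n k A)" if "e \<in> monoid_span A" for e
    using that keys [OF that] k
    by (auto simp: monoid_span_polarize keys_pi_section pi_map_pi_section)
  show "normal_monoid (monoid_span A)"
    unfolding normal_monoid_def
  proof (intro ballI allI impI)
    fix a b m and c :: nat
    assume abm: "a \<in> monoid_span A" "b \<in> monoid_span A" "m \<in> monoid_span A"
      and c: "0 < c" "multiple c a = m + multiple c b"
    have "multiple c (pi_section a) = pi_section m + multiple c (pi_section b)"
      using c(2) by (simp flip: pi_section_multiple pi_section_add)
    then obtain r where "r \<in> monoid_span (polarize n k A)" "pi_section a = r + pi_section b"
      using norm abm [THEN sec] c(1) unfolding normal_monoid_def by meson
    \<comment> \<open>The solution \<open>r\<close> may lie outside the image of the section;
      applying \<open>pi_map\<close> to the equation is enough.\<close>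
    then have "pi_map r \<in> monoid_span A" "a = pi_map r + b"
      by (simp_all add: monoid_span_polarize) (metis pi_map_add pi_map_pi_section)
    then show "\<exists>r\<in>monoid_span A. a = r + b" by blast
  qed
next
  assume norm: "normal_monoid (monoid_span A)"
  show "normal_monoid (monoid_span (polarize n k A))"
    unfolding normal_monoid_def
  proof (intro ballI allI impI)
    fix a b m and c :: nat
    assume a: "a \<in> monoid_span (polarize n k A)" and b: "b \<in> monoid_span (polarize n k A)"
      and m: "m \<in> monoid_span (polarize n k A)"
      and c: "0 < c" "multiple c a = m + multiple c b"
    have "multiple c (pi_map a) = pi_map m + multiple c (pi_map b)"
      using c(2) by (simp flip: pi_map_multiple pi_map_add)
    moreover have "pi_map a \<in> monoid_span A" "pi_map b \<in> monoid_span A" "pi_map m \<in> monoid_span A"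
      using a b m by (simp_all add: monoid_span_polarize)
    ultimately obtain r where r: "r \<in> monoid_span A" "pi_map a = r + pi_map b"
      using norm c(1) unfolding normal_monoid_def by meson
    \<comment> \<open>The subtraction does not truncate: \<open>c * b \<le> c * a\<close> in every
      coordinate, and \<open>c > 0\<close>.\<close>
    define s where "s = a - b"
    have s: "a = s + b"
    proof (rule poly_mapping_eqI)
      fix x
      have "c * Poly_Mapping.lookup b x \<le> c * Poly_Mapping.lookup a x"
        using arg_cong [OF c(2), of "\<lambda>e. Poly_Mapping.lookup e x"] by (simp add: lookup_add)
      then show "Poly_Mapping.lookup a x = Poly_Mapping.lookup (s + b) x"
        using c(1) by (simp add: s_def lookup_add lookup_minus)
    qed
    then have "pi_map s = r"
      using r(2) by (simp add: pi_map_add)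
    moreover have "Poly_Mapping.keys s \<subseteq> Poly_Mapping.keys a"
      unfolding s keys_add_nat by blast
    ultimately have "s \<in> monoid_span (polarize n k A)"
      using a r(1) by (auto simp: monoid_span_polarize)
    then show "\<exists>r\<in>monoid_span (polarize n k A). a = r + b"
      using s by blast
  qed
qed

theorem theorem2p16:
  fixes n :: nat and k :: "nat \<Rightarrow> nat" and A :: "(nat \<Rightarrow>\<^sub>0 nat) set"
  assumes "\<forall>i\<in>{1..n}. k i \<ge> 1"
    and "finite A" and "A \<subseteq> monomials_S n"
    and "\<forall>u\<in>A. \<forall>v\<in>A. mdvd u v \<longrightarrow> u = v"
  shows "normal_subring (kalg A :: (nat, 'k::field) mpoly set)
     \<longleftrightarrow> normal_subring (kalg (polarize n k A) :: (nat \<times> nat, 'k) mpoly set)"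
  \<comment> \<open>On the polarized side the variables are pairs, ordered lexicographically, so
    \<open>normal_kalg_iff\<close> applies to both algebras.\<close>
  using assms
  by (simp add: normal_kalg_iff finite_polarize normal_monoid_span_polarize_iff)

end
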